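(* Let $K$ (the same index as used in the update rule for $\epsilon_n$ of the IRLS algorithm described in the context) be chosen so that $\Phi$ satisfies the Null Space Property of order $K$ with constant $\gamma<1$. Then, for each $y\in\mathbb{R}^m$, the output $(x^n)$ of the algorithm converges to a vector $\bar x\in\mathbb{R}^N$, with $r(\bar x)_{K+1}=N\lim_{n\to\infty}\epsilon_n$, and, writing $\epsilon:=\lim_{n\to\infty}\epsilon_n$, the following hold: (i) If $\epsilon=0$, then $\bar x$ is $K$-sparse; in this case there is therefore a unique $\ell_1$-minimizer $x^*$ in $\mathcal{F}(y)$, and $\bar x=x^*$; moreover, for $k\le K$ and any $z\in\mathcal{F}(y)$, $$\|z-\bar x\|_{\ell_1}\le c\,\sigma_k(z)_{\ell_1},\qquad c:=\frac{2(1+\gamma)}{1-\gamma}.$$ (ii) If $\epsilon>0$, then $\bar x=x^{\epsilon}$, where $x^\epsilon$ is the unique minimizer over $\mathcal{F}(y)$ of $f_\epsilon(z)=\sum_{j=1}^N(z_j^2+\epsilon^2)^{1/2}$. (iii) In this last case ($\epsilon>0$), if $\gamma$ satisfies the stricter bound $\gamma<1-\frac{2}{K+2}$ (or, equivalently, if $\frac{2\gamma}{1-\gamma}<K$), then for all $z\in\mathcal{F}(y)$ and any $k<K-\frac{2\gamma}{1-\gamma}$, $$\|z-\bar x\|_{\ell_1}\le \tilde c\,\sigma_k(z)_{\ell_1},\qquad \tilde c:=\frac{2(1+\gamma)}{1-\gamma}\left[\frac{K-k+\frac32}{K-k-\frac{2\gamma}{1-\gamma}}\right].$$ As a consequence,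 this case ($\epsilon>0$) is excluded if $\mathcal{F}(y)$ contains a vector of sparsity $k<K-\frac{2\gamma}{1-\gamma}$.
   Context: Setting: $m<N$ are positive integers, $\Phi$ is a real $m\times N$ matrix of full rank $m$, $y\in\mathbb{R}^m$, $\mathcal{N}:=\ker\Phi\subset\mathbb{R}^N$, $\mathcal{F}(y):=\{z\in\mathbb{R}^N:\Phi z=y\}$. $K$ is a fixed positive integer; $k$ denotes a nonnegative integer. A vector is $k$-sparse (has sparsity $k$) if it has at most $k$ nonzero coordinates. For $z\in\mathbb{R}^N$, $r(z)$ is the non-increasing rearrangement of $(|z_1|,\dots,|z_N|)$, i.e. $r(z)_i$ is the $i$-th largest of the $|z_j|$ (counted with multiplicity). $\sigma_k(z)_{\ell_1}:=\inf\{\|z-w\|_{\ell_1}: w \text{ is } k\text{-sparse}\}=\sum_{\nu>k}r(z)_\nu$. An $\ell_1$-minimizer in $\mathcal{F}(y)$ is an element of $\mathcal{F}(y)$ of minimal $\ell_1$-norm. Null Space Property (NSP): $\Phi$ has the NSP of order $L$ with constant $\gamma>0$ if $\|\eta_T\|_{\ell_1}\le\gamma\|\eta_{T^c}\|_{\ell_1}$ for all $\eta\in\mathcal{N}$ and all $T\subset\{1,\dots,N\}$ with $\#T\le L$; here $\eta_S$ is obtained from $\eta$ by setting to zero all coordinates with index not in $S$, and $T^c$ is the complement of $T$. IRLS algorithm: set $w^0:=(1,\dots,1)$, $\epsilon_0:=1$. For $n=0,1,2,\dots$ define $$x^{n+1}:=\arg\min_{z\in\mathcal{F}(y)}\sum_{j=1}^N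 w^n_j z_j^2,\qquad \epsilon_{n+1}:=\min\Big(\epsilon_n,\frac{r(x^{n+1})_{K+1}}{N}\Big),\qquad w^{n+1}_j:=\big[(x^{n+1}_j)^2+\epsilon_{n+1}^2\big]^{-1/2}.$$ If $\epsilon_n=0$ the algorithm stops and one sets $x^j:=x^n$ for $j>n$ (so that $\lim_{n\to\infty}\epsilon_n=0$ in this case).
   Formalization: The clause r(x̄)_{K+1} = N lim ε_n is false in general (ε_n may stay at ε_0 = 1); it is replaced by N lim ε_n ≤ r(x̄)_{K+1}, with equality if ε = 0 or if ε_n = r(x^n)_{K+1}/N for infinitely many n. *)

theory Defs
  imports "HOL-Analysis.Analysis" "HOL-Library.Multiset"
begin

definition feasible :: "real^'n^'m \<Rightarrow> real^'m \<Rightarrow> (real^'n) set" where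
  "feasible \<Phi> y = {z. \<Phi> *v z = y}"

definition l1norm :: "real^'n \<Rightarrow> real" where
  "l1norm z = (\<Sum>j\<in>UNIV. \<bar>z $ j\<bar>)"

definition k_sparse :: "nat \<Rightarrow> real^'n \<Rightarrow> bool" where
  "k_sparse k z \<longleftrightarrow> card {j. z $ j \<noteq> 0} \<le> k"

(* The rank i is counted from 1, so that rearr z 1 is the largest absolute value;
   the value is meaningful only for i between 1 and CARD('n). *)
definition rearr :: "real^'n \<Rightarrow> nat \<Rightarrow> real" where
  "rearr z i = rev (sorted_list_of_multiset (image_mset (\<lambda>j. \<bar>z $ j\<bar>) (mset_set UNIV))) ! (i - 1)"

definition sigma_l1 :: "nat \<Rightarrow> real^'n \<Rightarrow> real" where
  "sigma_l1 k z = (INF w\<in>{w. k_sparse k w}. l1norm (z - w))"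

definition restrict_to :: "'n set \<Rightarrow> real^'n \<Rightarrow> real^'n" where
  "restrict_to T \<eta> = (\<chi> j. if j \<in> T then \<eta> $ j else 0)"

definition null_space_property :: "real^'n^'m \<Rightarrow> nat \<Rightarrow> real \<Rightarrow> bool" where
  "null_space_property \<Phi> L \<gamma> \<longleftrightarrow> 0 < \<gamma> \<and>
     (\<forall>\<eta> T. \<Phi> *v \<eta> = 0 \<longrightarrow> card T \<le> L \<longrightarrow>
        l1norm (restrict_to T \<eta>) \<le> \<gamma> * l1norm (restrict_to (- T) \<eta>))"

definition l1_minimizer :: "real^'n^'m \<Rightarrow> real^'m \<Rightarrow> real^'n \<Rightarrow> bool" where
  "l1_minimizer \<Phi> y x \<longleftrightarrow> is_arg_min l1norm (\<lambda>z. z \<in> feasible \<Phi> y) x"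

definition f_eps :: "real \<Rightarrow> real^'n \<Rightarrow> real" where
  "f_eps \<epsilon> z = (\<Sum>j\<in>UNIV. sqrt ((z $ j)\<^sup>2 + \<epsilon>\<^sup>2))"

(* State of the IRLS iteration: (x^n, eps_n, w^n).  There is no iterate x^0; its entry is a
   placeholder that no later step reads (eps_0 = 1, so the algorithm cannot stop at n = 0).
   Once eps_n = 0 the state is frozen.  The minimizer chosen by ARG_MIN exists and is unique
   whenever the linear system is solvable, since all weights are then positive. *)
definition irls_step ::
  "real^'n^'m \<Rightarrow> real^'m \<Rightarrow> nat \<Rightarrow> (real^'n) \<times> real \<times> (real^'n) \<Rightarrow> (real^'n) \<times> real \<times> (real^'n)" where
  "irls_step \<Phi> y K = (\<lambda>(x, \<epsilon>, w).
     if \<epsilon> = 0 then (x, \<epsilon>, w)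
     else
       let x' = (ARG_MIN (\<lambda>z. \<Sum>j\<in>UNIV. w $ j * (z $ j)\<^sup>2) z. z \<in> feasible \<Phi> y);
           \<epsilon>' = min \<epsilon> (rearr x' (K + 1) / real CARD('n));
           w' = (\<chi> j. ((x' $ j)\<^sup>2 + \<epsilon>'\<^sup>2) powr (- 1 / 2))
       in (x', \<epsilon>', w'))"

primrec irls ::
  "real^'n^'m \<Rightarrow> real^'m \<Rightarrow> nat \<Rightarrow> nat \<Rightarrow> (real^'n) \<times> real \<times> (real^'n)" where
  "irls \<Phi> y K 0 = (0, 1, \<chi> j. 1)"
| "irls \<Phi> y K (Suc n) = irls_step \<Phi> y K (irls \<Phi> y K n)"

definition irls_x :: "real^'n^'m \<Rightarrow> real^'m \<Rightarrow> nat \<Rightarrow> nat \<Rightarrow> real^'n" where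
  "irls_x \<Phi> y K n = fst (irls \<Phi> y K n)"

definition irls_eps :: "real^'n^'m \<Rightarrow> real^'m \<Rightarrow> nat \<Rightarrow> nat \<Rightarrow> real" where
  "irls_eps \<Phi> y K n = fst (snd (irls \<Phi> y K n))"

(* The clause "r(xbar)_{K+1} = N * lim eps_n" does not hold without a further hypothesis, because
   eps_n is a running minimum that also involves eps_0 = 1: for N = 3, m = 2, K = 1, kernel
   spanned by (1,1,1) (null space property of order 1 with constant 1/2) and
   F(y) = (-10,0,10) + kernel, every iterate is (-10,0,10) and every eps_n is 1, so
   r(xbar)_2 = 10 while N * lim eps_n = 3.  In general N * lim eps_n <= r(xbar)_{K+1}, with
   equality if lim eps_n = 0, and also if eps_n = r(x^n)_{K+1} / N for infinitely many n. *)
definition eps_from_iterate :: "real^'n^'m \<Rightarrow> real^'m \<Rightarrow> nat \<Rightarrow> nat \<Rightarrow> bool" where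
  "eps_from_iterate \<Phi> y K n \<longleftrightarrow>
     irls_eps \<Phi> y K (Suc n) = rearr (irls_x \<Phi> y K (Suc n)) (K + 1) / real CARD('n)"

end

theory Submission
  imports Defs
begin

text \<open>
The algorithm is a descent method for a functional that changes with \<open>\<epsilon>\<close>. Since the
weights are \<open>w_j = (x_j\<^sup>2 + \<epsilon>\<^sup>2) powr (- 1 / 2)\<close>, the quadratic form with these weights
is, up to a factor 2 and a constant, a majorant of \<open>f_eps \<epsilon>\<close> that touches it at the current
iterate, because the square root is concave. One least squares step therefore lowers
\<open>f_eps \<epsilon>\<close>, and lowering \<open>\<epsilon>\<close> afterwards can only lower it further. The size of
the drop controls the weighted distance between two successive iterates
(\<open>irls_energy_drop\<close>). Consequently the iterates are bounded, and the limit of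
\<open>f_eps (E n) (X n)\<close> exists, where \<open>X n\<close> and \<open>E n\<close> are the iterate and the
regularization parameter of step \<open>n\<close>.

Let \<open>\<epsilon>\<close> be the limit of the decreasing sequence \<open>E\<close>.

If \<open>\<epsilon> > 0\<close>, the algorithm never stops, and the weights stay bounded away from zero, so the
drops of the energy force successive iterates together. The weights also stay bounded and depend
continuously on the iterate down to the limit. Hence the normal equations of the least squares
problem, which involve the weights of one iterate and the entries of the next, become at every
cluster point the stationarity condition for the strictly convex \<open>f_eps \<epsilon>\<close> on the feasible set. There is
only one stationary point, so the bounded sequence of iterates converges to it.

If \<open>\<epsilon> = 0\<close>, the \<open>(K+1)\<close>-st largest entry of the iterates comes arbitrarily close to
zero, so some cluster point is \<open>K\<close>-sparse. By the null space property a \<open>K\<close>-sparse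
feasible vector is the unique l1 minimizer, and the l1 distance to it is bounded by a multiple of
the excess in l1 norm (\<open>sparse_l1_distance\<close>). The monotone energy differs from the l1 norm by
at most \<open>N * E n\<close>, with \<open>N\<close> the number of coordinates, which makes this excess tend to
zero along the whole sequence.

The error bounds follow from the null space estimate \<open>null_space_l1_estimate\<close>, applied to the
limit. In the case \<open>\<epsilon> > 0\<close> the limit is only an approximate l1 minimizer, with excess at
most \<open>N * \<epsilon>\<close>; but \<open>N * \<epsilon>\<close> is bounded by the \<open>(K+1)\<close>-st largest entry of
the limit, and that entry is in turn bounded by the error of best \<open>k\<close>-term approximation and
the distance being estimated (\<open>rearr_le_l1_sigma\<close>). Resolving this circular inequality needs
the gap between \<open>k\<close> and \<open>K\<close>.
\<close>

section \<open>The l1 norm and best sparse approximation\<close>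

lemma l1norm_nonneg: "0 \<le> l1norm z"
  by (simp add: l1norm_def sum_nonneg)

lemma l1norm_triangle: "l1norm (x - z) \<le> l1norm (x - y) + l1norm (y - z)"
  unfolding l1norm_def sum.distrib[symmetric] by (rule sum_mono) simp

lemma l1norm_commute: "l1norm (x - y) = l1norm (y - x)"
  by (simp add: l1norm_def abs_minus_commute)

lemma norm_le_l1norm: "norm z \<le> l1norm z"
  by (simp add: l1norm_def norm_le_l1_cart)

lemma continuous_l1norm: "continuous_on UNIV l1norm"
  unfolding l1norm_def by (intro continuous_intros)

text \<open>
Lower bounds on \<open>sigma_l1\<close> come from this rule: an estimate is shown against an arbitrary
\<open>k\<close>-sparse competitor \<open>w\<close>, so no best approximation has to be identified.
\<close>

lemma le_sigma_l1:
  assumes "\<And>w. k_sparse k w \<Longrightarrow> a \<le> l1norm (z - w)"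
  shows "a \<le> sigma_l1 k z"
proof -
  have "k_sparse k 0" by (simp add: k_sparse_def)
  then show ?thesis unfolding sigma_l1_def by (intro cINF_greatest) (use assms in auto)
qed

lemma sigma_l1_nonneg: "0 \<le> sigma_l1 k z"
  by (rule le_sigma_l1) (rule l1norm_nonneg)

lemma sigma_l1_sparse:
  assumes "k_sparse k z"
  shows "sigma_l1 k z = 0"
proof -
  have "bdd_below ((\<lambda>w. l1norm (z - w)) ` {w. k_sparse k w})"
    by (rule bdd_belowI2[where m = 0]) (rule l1norm_nonneg)
  then have "sigma_l1 k z \<le> l1norm (z - z)"
    unfolding sigma_l1_def by (rule cINF_lower) (use assms in simp)
  then show ?thesis using sigma_l1_nonneg[of k z] by (simp add: l1norm_def)
qed

lemma feasible_diff:
  assumes "z \<in> feasible \<Phi> y" "z' \<in> feasible \<Phi> y"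
  shows "\<Phi> *v (z - z') = 0"
  using assms by (simp add: feasible_def matrix_vector_mult_diff_distrib)

lemma closed_feasible: "closed (feasible \<Phi> y)"
proof -
  have "continuous_on UNIV (\<lambda>z. \<Phi> *v z)"
    by (simp add: linear_continuous_on matrix_vector_mul_bounded_linear)
  then show ?thesis
    unfolding feasible_def by (intro closed_Collect_eq continuous_on_const)
qed

section \<open>Consequences of the null space property\<close>

lemma null_space_property_sum:
  assumes "null_space_property \<Phi> L \<gamma>" "\<Phi> *v \<eta> = 0" "card T \<le> L"
  shows "(\<Sum>j\<in>T. \<bar>\<eta> $ j\<bar>) \<le> \<gamma> * (\<Sum>j\<in>-T. \<bar>\<eta> $ j\<bar>)"
proof -
  have restr: "l1norm (restrict_to S \<eta>) = (\<Sum>j\<in>S. \<bar>\<eta> $ j\<bar>)" for S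
    unfolding l1norm_def restrict_to_def
    by (rule sum.mono_neutral_cong_right) auto
  have "l1norm (restrict_to T \<eta>) \<le> \<gamma> * l1norm (restrict_to (-T) \<eta>)"
    using assms by (simp add: null_space_property_def)
  then show ?thesis unfolding restr .
qed

text \<open>
An underdetermined matrix has a nonzero kernel vector \<open>\<eta>\<close>; if the index set of all coordinates
were admissible in the null space property, the complement would be empty and force
\<open>\<eta> = 0\<close>. In particular the rank \<open>K + 1\<close> read by the algorithm is a genuine one.
\<close>

lemma null_space_property_order_less:
  fixes \<Phi> :: "real^'n^'m"
  assumes "null_space_property \<Phi> K \<gamma>" "CARD('m) < CARD('n)" "rank \<Phi> = CARD('m)"
  shows "K < CARD('n)"
proof (rule ccontr)
  assume "\<not> K < CARD('n)"
  then have K: "card (UNIV :: 'n set) \<le> K" by simp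
  from assms obtain \<eta> where \<eta>: "\<eta> \<noteq> 0" "\<Phi> *v \<eta> = 0"
    using matrix_nonfull_linear_equations_eq[of \<Phi>] by auto
  have "(\<Sum>j\<in>UNIV. \<bar>\<eta> $ j\<bar>) \<le> 0"
    using null_space_property_sum[OF assms(1) \<eta>(2) K] by simp
  then have "norm \<eta> \<le> 0" using norm_le_l1_cart[of \<eta>] by linarith
  with \<eta>(1) show False by simp
qed

text \<open>
With \<open>T\<close> the support of a sparse competitor for \<open>z\<close> and \<open>\<eta> = z' - z\<close>, the mass
of \<open>\<eta>\<close> off \<open>T\<close> is at most the difference of the l1 norms plus the mass of \<open>\<eta>\<close>
on \<open>T\<close> plus twice the tail of \<open>z\<close>. The null space property bounds the mass on \<open>T\<close>
by \<open>\<gamma>\<close> times the mass off \<open>T\<close>, and since \<open>\<gamma> < 1\<close> it can be absorbed.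
\<close>

lemma null_space_l1_estimate:
  assumes nsp: "null_space_property \<Phi> L \<gamma>" and \<gamma>: "\<gamma> < 1"
    and feas: "z \<in> feasible \<Phi> y" "z' \<in> feasible \<Phi> y" and k: "k \<le> L"
  shows "l1norm (z' - z) \<le> (1 + \<gamma>) / (1 - \<gamma>) * (l1norm z' - l1norm z + 2 * sigma_l1 k z)"
proof -
  have \<gamma>0: "0 < \<gamma>" using nsp by (simp add: null_space_property_def)
  let ?c = "(1 + \<gamma>) / (1 - \<gamma>)"
  have c0: "0 < ?c" using \<gamma> \<gamma>0 by simp
  have key: "l1norm (z' - z) / ?c \<le> l1norm z' - l1norm z + 2 * l1norm (z - w)"
    if w: "k_sparse k w" for w
  proof -
    define T where "T = {j. w $ j \<noteq> 0}"
    define \<eta> where "\<eta> = z' - z"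
    have split: "l1norm v = (\<Sum>j\<in>T. \<bar>v $ j\<bar>) + (\<Sum>j\<in>-T. \<bar>v $ j\<bar>)" for v
      unfolding l1norm_def by (subst sum.union_disjoint[symmetric]) auto
    have T: "card T \<le> L" using w k by (simp add: k_sparse_def T_def)
    have nsp_T: "(\<Sum>j\<in>T. \<bar>\<eta> $ j\<bar>) \<le> \<gamma> * (\<Sum>j\<in>-T. \<bar>\<eta> $ j\<bar>)"
      by (rule null_space_property_sum[OF nsp _ T]) (simp add: \<eta>_def feasible_diff[OF feas(2,1)])
    have out: "(\<Sum>j\<in>-T. \<bar>\<eta> $ j\<bar>) \<le> (\<Sum>j\<in>-T. \<bar>z' $ j\<bar>) + (\<Sum>j\<in>-T. \<bar>z $ j\<bar>)"
      unfolding sum.distrib[symmetric] \<eta>_def by (rule sum_mono) simp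
    have inn: "(\<Sum>j\<in>T. \<bar>z $ j\<bar>) \<le> (\<Sum>j\<in>T. \<bar>z' $ j\<bar>) + (\<Sum>j\<in>T. \<bar>\<eta> $ j\<bar>)"
      unfolding sum.distrib[symmetric] \<eta>_def by (rule sum_mono) simp
    have tail: "(\<Sum>j\<in>-T. \<bar>z $ j\<bar>) \<le> l1norm (z - w)"
    proof -
      have "(\<Sum>j\<in>-T. \<bar>z $ j\<bar>) = (\<Sum>j\<in>-T. \<bar>(z - w) $ j\<bar>)"
        by (rule sum.cong) (auto simp: T_def)
      also have "\<dots> \<le> l1norm (z - w)"
        unfolding l1norm_def by (rule sum_mono2) auto
      finally show ?thesis .
    qed
    have "(1 - \<gamma>) * (\<Sum>j\<in>-T. \<bar>\<eta> $ j\<bar>) \<le> l1norm z' - l1norm z + 2 * l1norm (z - w)"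
      using nsp_T out inn tail split[of z] split[of z'] by (simp add: algebra_simps)
    moreover have "l1norm \<eta> \<le> (1 + \<gamma>) * (\<Sum>j\<in>-T. \<bar>\<eta> $ j\<bar>)"
      using nsp_T split[of \<eta>] by (simp add: algebra_simps)
    then have "l1norm \<eta> / (1 + \<gamma>) \<le> (\<Sum>j\<in>-T. \<bar>\<eta> $ j\<bar>)"
      using \<gamma>0 by (simp add: pos_divide_le_eq mult.commute)
    then have "(1 - \<gamma>) * (l1norm \<eta> / (1 + \<gamma>)) \<le> (1 - \<gamma>) * (\<Sum>j\<in>-T. \<bar>\<eta> $ j\<bar>)"
      using \<gamma> by (intro mult_left_mono) auto
    then have "l1norm \<eta> / ?c \<le> (1 - \<gamma>) * (\<Sum>j\<in>-T. \<bar>\<eta> $ j\<bar>)"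
      by (simp add: mult.commute)
    ultimately show ?thesis by (simp add: \<eta>_def)
  qed
  have "(l1norm (z' - z) / ?c - l1norm z' + l1norm z) / 2 \<le> sigma_l1 k z"
    by (rule le_sigma_l1) (use key in \<open>simp add: field_simps\<close>)
  then have "l1norm (z' - z) / ?c \<le> l1norm z' - l1norm z + 2 * sigma_l1 k z" by simp
  then show ?thesis using c0 by (simp only: pos_divide_le_eq mult.commute)
qed

text \<open>
For a sparse vector the approximation error in \<open>null_space_l1_estimate\<close> vanishes. As the left
side of that estimate is a norm, the remaining difference of l1 norms is nonnegative, and it is zero
only at the vector itself.
\<close>

lemma sparse_l1_minimizer:
  assumes nsp: "null_space_property \<Phi> K \<gamma>" and \<gamma>: "\<gamma> < 1"
    and x: "x \<in> feasible \<Phi> y" "k_sparse K x"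
  shows sparse_l1_distance:
      "z \<in> feasible \<Phi> y \<Longrightarrow> l1norm (z - x) \<le> (1 + \<gamma>) / (1 - \<gamma>) * (l1norm z - l1norm x)"
    and sparse_l1_le: "z \<in> feasible \<Phi> y \<Longrightarrow> l1norm x \<le> l1norm z"
    and sparse_l1_is_minimizer: "l1_minimizer \<Phi> y x"
    and sparse_l1_unique: "l1_minimizer \<Phi> y x' \<Longrightarrow> x' = x"
proof -
  have c0: "0 < (1 + \<gamma>) / (1 - \<gamma>)"
    using nsp \<gamma> by (simp add: null_space_property_def)
  show dist: "l1norm (z - x) \<le> (1 + \<gamma>) / (1 - \<gamma>) * (l1norm z - l1norm x)"
    if "z \<in> feasible \<Phi> y" for z
    using null_space_l1_estimate[OF nsp \<gamma> x(1) that order_refl] by (simp add: sigma_l1_sparse[OF x(2)])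
  show le: "l1norm x \<le> l1norm z" if "z \<in> feasible \<Phi> y" for z
  proof -
    have "0 \<le> (1 + \<gamma>) / (1 - \<gamma>) * (l1norm z - l1norm x)"
      using dist[OF that] l1norm_nonneg[of "z - x"] by linarith
    then show ?thesis using c0 by (metis zero_le_mult_iff not_less diff_ge_0_iff_ge)
  qed
  show "l1_minimizer \<Phi> y x"
    unfolding l1_minimizer_def is_arg_min_linorder using le x(1) by blast
  show "x' = x" if "l1_minimizer \<Phi> y x'"
  proof -
    have f: "x' \<in> feasible \<Phi> y" and "l1norm x' \<le> l1norm x"
      using that x(1) by (auto simp: l1_minimizer_def is_arg_min_linorder)
    then have "(1 + \<gamma>) / (1 - \<gamma>) * (l1norm x' - l1norm x) \<le> 0"
      using c0 by (intro mult_nonneg_nonpos) auto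
    then have "l1norm (x' - x) \<le> 0" using dist[OF f] by linarith
    then have "norm (x' - x) \<le> 0" using norm_le_l1norm[of "x' - x"] by linarith
    then show ?thesis by simp
  qed
qed

section \<open>The non-increasing rearrangement\<close>

text \<open>
This replaces the sorted list by a count, from which every later property of the rearrangement is
derived. In a descending list the entries at or above the level \<open>t\<close> form an initial segment,
so their number decides whether position \<open>i\<close> belongs to it.
\<close>

lemma le_rearr_iff:
  fixes z :: "real^'n"
  assumes "1 \<le> i" "i \<le> CARD('n)"
  shows "t \<le> rearr z i \<longleftrightarrow> i \<le> card {j. t \<le> \<bar>z $ j\<bar>}"
proof -
  define M where "M = image_mset (\<lambda>j. \<bar>z $ j\<bar>) (mset_set UNIV)"
  define xs where "xs = rev (sorted_list_of_multiset M)"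
  have ms: "mset xs = M" by (simp add: xs_def)
  have len: "length xs = CARD('n)"
    using arg_cong[OF ms, of size] by (simp add: M_def)
  have sorted: "xs ! b \<le> xs ! a" if "a \<le> b" "b < length xs" for a b
    using that sorted_sorted_list_of_multiset[of M] unfolding xs_def
    by (metis sorted_rev_nth_mono rev_rev_ident)
  have "card {j. t \<le> \<bar>z $ j\<bar>} = size (filter_mset (\<lambda>x. t \<le> x) M)"
    by (simp add: M_def filter_mset_image_mset)
  also have "\<dots> = card {a. a < length xs \<and> t \<le> xs ! a}"
    unfolding ms[symmetric] length_filter_conv_card[symmetric] by (metis mset_filter size_mset)
  finally have card: "card {j. t \<le> \<bar>z $ j\<bar>} = card {a. a < length xs \<and> t \<le> xs ! a}" .
  have r: "rearr z i = xs ! (i - 1)" by (simp add: rearr_def xs_def M_def)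
  show ?thesis
  proof
    assume "t \<le> rearr z i"
    then have "t \<le> xs ! a" if "a < i" for a
      using sorted[of a "i - 1"] that assms len r by force
    then have "{..<i} \<subseteq> {a. a < length xs \<and> t \<le> xs ! a}"
      using assms(2) len by auto
    then have "card {..<i} \<le> card {a. a < length xs \<and> t \<le> xs ! a}" by (intro card_mono) auto
    then show "i \<le> card {j. t \<le> \<bar>z $ j\<bar>}" using card by simp
  next
    assume i: "i \<le> card {j. t \<le> \<bar>z $ j\<bar>}"
    show "t \<le> rearr z i"
    proof (rule ccontr)
      assume "\<not> t \<le> rearr z i"
      then have "a < i - 1" if "a < length xs" "t \<le> xs ! a" for a
        using sorted[of "i - 1" a] that r by (cases "a < i - 1") auto
      then have "{a. a < length xs \<and> t \<le> xs ! a} \<subseteq> {..<i - 1}" by auto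
      then have "card {a. a < length xs \<and> t \<le> xs ! a} \<le> card {..<i - 1}" by (intro card_mono) auto
      then show False using i card assms by simp
    qed
  qed
qed

lemma rearr_nonneg:
  fixes z :: "real^'n"
  assumes "1 \<le> i" "i \<le> CARD('n)"
  shows "0 \<le> rearr z i"
  by (subst le_rearr_iff[OF assms]) (use assms in simp)

text \<open>
Passing from \<open>z\<close> to \<open>z'\<close> lowers each absolute value by at most \<open>norm (z - z')\<close>, so
the coordinates counted for \<open>z\<close> at a level are counted for \<open>z'\<close> at the level lowered by this
amount.
\<close>

lemma rearr_lipschitz:
  fixes z z' :: "real^'n"
  assumes "1 \<le> i" "i \<le> CARD('n)"
  shows "rearr z i - norm (z - z') \<le> rearr z' i"
proof (subst le_rearr_iff[OF assms])
  have "\<bar>z $ j\<bar> \<le> \<bar>z' $ j\<bar> + norm (z - z')" for j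
    using component_le_norm_cart[of "z - z'" j] by simp
  then have "{j. rearr z i \<le> \<bar>z $ j\<bar>} \<subseteq> {j. rearr z i - norm (z - z') \<le> \<bar>z' $ j\<bar>}"
    by (auto simp: diff_le_eq intro: order_trans)
  then have "card {j. rearr z i \<le> \<bar>z $ j\<bar>} \<le> card {j. rearr z i - norm (z - z') \<le> \<bar>z' $ j\<bar>}"
    by (intro card_mono) auto
  then show "i \<le> card {j. rearr z i - norm (z - z') \<le> \<bar>z' $ j\<bar>}"
    using le_rearr_iff[OF assms, of "rearr z i" z] by simp
qed

lemma tendsto_rearr:
  fixes X :: "nat \<Rightarrow> real^'n"
  assumes "1 \<le> i" "i \<le> CARD('n)" and X: "X \<longlonglongrightarrow> x"
  shows "(\<lambda>n. rearr (X n) i) \<longlonglongrightarrow> rearr x i"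
proof -
  have "norm (rearr (X n) i - rearr x i) \<le> norm (X n - x)" for n
    using rearr_lipschitz[OF assms(1,2), of "X n" x] rearr_lipschitz[OF assms(1,2), of x "X n"]
    by (simp add: norm_minus_commute)
  moreover have "(\<lambda>n. norm (X n - x)) \<longlonglongrightarrow> 0"
    by (rule tendsto_norm_zero[OF LIM_zero[OF X]])
  ultimately have "(\<lambda>n. rearr (X n) i - rearr x i) \<longlonglongrightarrow> 0"
    by (rule Lim_null_comparison[OF always_eventually[OF allI]])
  then show ?thesis by (rule LIM_zero_cancel)
qed

lemma rearr_eq_0_imp_sparse:
  fixes z :: "real^'n"
  assumes "K < CARD('n)" "rearr z (K + 1) = 0"
  shows "k_sparse K z"
proof (rule ccontr)
  assume "\<not> k_sparse K z"
  then have card: "K + 1 \<le> card {j. z $ j \<noteq> 0}" by (simp add: k_sparse_def)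
  \<comment> \<open>The smallest nonzero absolute value is a positive level reached by more than \<open>K\<close> entries.\<close>
  define t where "t = Min ((\<lambda>j. \<bar>z $ j\<bar>) ` {j. z $ j \<noteq> 0})"
  have "{j. z $ j \<noteq> 0} \<noteq> {}" using card by (metis Suc_eq_plus1 card.empty not_less_eq_eq zero_le)
  then have t: "0 < t" by (auto simp: t_def Min_gr_iff)
  have "{j. z $ j \<noteq> 0} \<subseteq> {j. t \<le> \<bar>z $ j\<bar>}" by (auto simp: t_def)
  then have "card {j. z $ j \<noteq> 0} \<le> card {j. t \<le> \<bar>z $ j\<bar>}" by (intro card_mono) auto
  then have "t \<le> rearr z (K + 1)" using card assms(1) by (subst le_rearr_iff) auto
  then show False using t assms(2) by simp
qed

text \<open>
At least \<open>J\<close> entries of \<open>x\<close> are as large as the \<open>J\<close>-th largest one, and a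
\<open>k\<close>-sparse vector can match at most \<open>k\<close> of them, so it misses \<open>x\<close> by at least
\<open>J - k\<close> times that value. The triangle inequality moves the approximation from \<open>x\<close> to
\<open>z\<close>.
\<close>

lemma rearr_le_l1_sigma:
  fixes x z :: "real^'n"
  assumes "1 \<le> J" "J \<le> CARD('n)" "k \<le> J"
  shows "(real J - real k) * rearr x J \<le> l1norm (x - z) + sigma_l1 k z"
proof -
  have "(real J - real k) * rearr x J - l1norm (x - z) \<le> l1norm (z - w)"
    if w: "k_sparse k w" for w
  proof -
    define S where "S = {j. rearr x J \<le> \<bar>x $ j\<bar>}"
    define T where "T = {j. w $ j \<noteq> 0}"
    have "J \<le> card S" using le_rearr_iff[OF assms(1,2), of "rearr x J" x] by (simp add: S_def)
    moreover have "card T \<le> k" using w by (simp add: k_sparse_def T_def)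
    moreover have "card S - card T \<le> card (S - T)" by (rule diff_card_le_card_Diff) simp
    ultimately have "real J - real k \<le> real (card (S - T))" using assms(3) by linarith
    then have "(real J - real k) * rearr x J \<le> real (card (S - T)) * rearr x J"
      by (rule mult_right_mono) (rule rearr_nonneg[OF assms(1,2)])
    also have "\<dots> = (\<Sum>j\<in>S - T. rearr x J)" by simp
    also have "\<dots> \<le> (\<Sum>j\<in>S - T. \<bar>(x - w) $ j\<bar>)"
      by (rule sum_mono) (auto simp: S_def T_def)
    also have "\<dots> \<le> l1norm (x - w)" unfolding l1norm_def by (rule sum_mono2) auto
    also have "\<dots> \<le> l1norm (x - z) + l1norm (z - w)" by (rule l1norm_triangle)
    finally show ?thesis by simp
  qed
  then have "(real J - real k) * rearr x J - l1norm (x - z) \<le> sigma_l1 k z" by (rule le_sigma_l1)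
  then show ?thesis by simp
qed

section \<open>Weighted least squares on an affine subspace\<close>

text \<open>
The entries of a feasible vector that does not exceed the value at some fixed feasible \<open>z0\<close> are
bounded because the weights are positive, so the minimum is attained on a compact box.
\<close>

lemma weighted_ls_minimizer_exists:
  fixes \<Phi> :: "real^'n^'m" and w :: "real^'n"
  assumes w: "\<And>j. 0 < w $ j" and ne: "feasible \<Phi> y \<noteq> {}"
  shows "\<exists>x. is_arg_min (\<lambda>z. \<Sum>j\<in>UNIV. w $ j * (z $ j)\<^sup>2) (\<lambda>z. z \<in> feasible \<Phi> y) x"
proof -
  define Q where "Q = (\<lambda>z::real^'n. \<Sum>j\<in>UNIV. w $ j * (z $ j)\<^sup>2)"
  obtain z0 where z0: "z0 \<in> feasible \<Phi> y" using ne by auto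
  \<comment> \<open>A single term of the sum already gives the bound \<open>w_j * z_j\<^sup>2 \<le> Q z0\<close>.\<close>
  define B :: "real^'n" where "B = (\<chi> j. sqrt (Q z0 / w $ j))"
  define S where "S = feasible \<Phi> y \<inter> cbox (-B) B"
  have inS: "z \<in> S" if z: "z \<in> feasible \<Phi> y" "Q z \<le> Q z0" for z
  proof -
    have "\<bar>z $ j\<bar> \<le> B $ j" for j
    proof -
      have "w $ j * (z $ j)\<^sup>2 \<le> Q z"
        unfolding Q_def by (rule member_le_sum) (use w in \<open>simp_all add: less_imp_le\<close>)
      then have "(z $ j)\<^sup>2 \<le> Q z0 / w $ j" using z(2) w[of j] by (simp add: field_simps)
      then show ?thesis by (simp add: B_def real_le_rsqrt)
    qed
    then have "z \<in> cbox (-B) B" by (simp add: mem_box_cart abs_le_iff minus_le_iff)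
    then show ?thesis using z(1) by (simp add: S_def)
  qed
  have "compact S" unfolding S_def by (intro closed_Int_compact closed_feasible compact_cbox)
  moreover have "z0 \<in> S" using inS z0 by simp
  moreover have "continuous_on S Q" unfolding Q_def by (intro continuous_intros)
  ultimately obtain x where x: "x \<in> S" "\<forall>z\<in>S. Q x \<le> Q z"
    using continuous_attains_inf[of S Q] by blast
  have "Q x \<le> Q z" if "z \<in> feasible \<Phi> y" for z
  proof (cases "Q z \<le> Q z0")
    case True then show ?thesis using x inS that by blast
  next
    case False then show ?thesis using x(2) \<open>z0 \<in> S\<close> by fastforce
  qed
  then have "is_arg_min Q (\<lambda>z. z \<in> feasible \<Phi> y) x"
    using x(1) by (auto simp: is_arg_min_linorder S_def)
  then show ?thesis unfolding Q_def by blast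
qed

lemma nonneg_quadratic_linear_coeff:
  fixes B C :: real
  assumes "\<And>t. 0 \<le> 2 * t * B + t\<^sup>2 * C" "0 \<le> C"
  shows "B = 0"
proof (rule ccontr)
  assume "B \<noteq> 0"
  \<comment> \<open>The point \<open>- B / (C + 1)\<close> stands in for the vertex \<open>- B / C\<close> and is defined also for \<open>C = 0\<close>.\<close>
  have "2 * (- B / (C + 1)) * B + (- B / (C + 1))\<^sup>2 * C = - (B\<^sup>2 * (C + 2)) / (C + 1)\<^sup>2"
    using assms(2) by (simp add: divide_simps power2_eq_square) (simp add: algebra_simps)
  also have "\<dots> < 0" using \<open>B \<noteq> 0\<close> assms(2) by (simp add: divide_neg_pos)
  finally show False using assms(1)[of "- B / (C + 1)"] by simp
qed

text \<open>
The normal equations: along \<open>x + t *\<^sub>R \<eta>\<close> the objective is a quadratic in \<open>t\<close> with its minimum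
at \<open>t = 0\<close>, so the linear coefficient vanishes.
\<close>

lemma weighted_ls_orthogonal:
  fixes \<Phi> :: "real^'n^'m" and w :: "real^'n"
  assumes w: "\<And>j. 0 < w $ j"
    and min: "is_arg_min (\<lambda>z. \<Sum>j\<in>UNIV. w $ j * (z $ j)\<^sup>2) (\<lambda>z. z \<in> feasible \<Phi> y) x"
    and \<eta>: "\<Phi> *v \<eta> = 0"
  shows "(\<Sum>j\<in>UNIV. w $ j * x $ j * \<eta> $ j) = 0"
proof (rule nonneg_quadratic_linear_coeff)
  show "0 \<le> (\<Sum>j\<in>UNIV. w $ j * (\<eta> $ j)\<^sup>2)"
    using w by (simp add: sum_nonneg less_imp_le)
  fix t :: real
  have "x + t *\<^sub>R \<eta> \<in> feasible \<Phi> y"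
    using min \<eta> by (simp add: is_arg_min_def feasible_def matrix_vector_right_distrib
        matrix_vector_mult_scaleR)
  then have "(\<Sum>j\<in>UNIV. w $ j * (x $ j)\<^sup>2) \<le> (\<Sum>j\<in>UNIV. w $ j * ((x + t *\<^sub>R \<eta>) $ j)\<^sup>2)"
    using min unfolding is_arg_min_linorder by blast
  also have "\<dots> = (\<Sum>j\<in>UNIV. w $ j * (x $ j)\<^sup>2) + (2 * t * (\<Sum>j\<in>UNIV. w $ j * x $ j * \<eta> $ j)
      + t\<^sup>2 * (\<Sum>j\<in>UNIV. w $ j * (\<eta> $ j)\<^sup>2))"
    unfolding sum_distrib_left sum.distrib[symmetric]
    by (rule sum.cong) (simp_all add: power2_eq_square algebra_simps)
  finally show "0 \<le> 2 * t * (\<Sum>j\<in>UNIV. w $ j * x $ j * \<eta> $ j)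
      + t\<^sup>2 * (\<Sum>j\<in>UNIV. w $ j * (\<eta> $ j)\<^sup>2)" by simp
qed

section \<open>The smoothed l1 functional\<close>

lemma l1norm_le_f_eps: "l1norm z \<le> f_eps e z"
  unfolding l1norm_def f_eps_def by (rule sum_mono) (simp add: real_le_rsqrt)

lemma f_eps_le_l1norm:
  fixes z :: "real^'n"
  assumes "0 \<le> e"
  shows "f_eps e z \<le> l1norm z + real CARD('n) * e"
proof -
  have "f_eps e z \<le> (\<Sum>j\<in>UNIV. \<bar>z $ j\<bar> + e)"
    unfolding f_eps_def
    by (rule sum_mono) (use assms in \<open>metis sqrt_sum_squares_le_sum_abs abs_of_nonneg\<close>)
  then show ?thesis by (simp add: sum.distrib l1norm_def)
qed

text \<open>
Strict convexity of \<open>\<lambda>t. sqrt (t\<^sup>2 + e\<^sup>2)\<close> in the form of a tangent line bound. Multiplied by the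
square root at \<open>x\<close>, it is the Cauchy-Schwarz inequality for the plane vectors \<open>(x, e)\<close> and
\<open>(z, e)\<close>, with the defect \<open>(e * (z - x))\<^sup>2\<close> given by the Lagrange identity.
\<close>

lemma sqrt_tangent_less:
  fixes x z e :: real
  assumes "0 < e" "x \<noteq> z"
  shows "sqrt (x\<^sup>2 + e\<^sup>2) + x * (z - x) / sqrt (x\<^sup>2 + e\<^sup>2) < sqrt (z\<^sup>2 + e\<^sup>2)"
proof -
  have p: "0 < x\<^sup>2 + e\<^sup>2" using assms(1) by (simp add: add_nonneg_pos)
  have "0 < (e * (z - x))\<^sup>2" using assms by simp
  also have "\<dots> = (z\<^sup>2 + e\<^sup>2) * (x\<^sup>2 + e\<^sup>2) - (x * z + e\<^sup>2)\<^sup>2"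
    by (simp add: power2_eq_square algebra_simps)
  finally have "x * z + e\<^sup>2 < sqrt ((z\<^sup>2 + e\<^sup>2) * (x\<^sup>2 + e\<^sup>2))"
    by (intro real_less_rsqrt) simp
  then have "(x * z + e\<^sup>2) / sqrt (x\<^sup>2 + e\<^sup>2) < sqrt (z\<^sup>2 + e\<^sup>2)"
    using p by (simp add: pos_divide_less_eq real_sqrt_mult)
  moreover have "sqrt (x\<^sup>2 + e\<^sup>2) + x * (z - x) / sqrt (x\<^sup>2 + e\<^sup>2) = (x * z + e\<^sup>2) / sqrt (x\<^sup>2 + e\<^sup>2)"
  proof -
    define s where "s = sqrt (x\<^sup>2 + e\<^sup>2)"
    have "0 < s" "s\<^sup>2 = x\<^sup>2 + e\<^sup>2" using p by (simp_all add: s_def)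
    then have "s + x * (z - x) / s = (x * z + e\<^sup>2) / s"
      by (simp add: field_simps power2_eq_square)
    then show ?thesis by (simp add: s_def)
  qed
  ultimately show ?thesis by simp
qed

text \<open>
Summing the tangent line bounds over the coordinates, the linear terms cancel by the stationarity
condition in the kernel direction \<open>z - x\<close>, and one coordinate gives a strict inequality. A
stationary point of \<open>f_eps e\<close> on the feasible set is thus its strict global minimizer.
\<close>

lemma f_eps_critical_less:
  fixes \<Phi> :: "real^'n^'m"
  assumes "0 < e" and feas: "x \<in> feasible \<Phi> y" "z \<in> feasible \<Phi> y" and "z \<noteq> x"
    and crit: "\<And>\<eta>. \<Phi> *v \<eta> = 0 \<Longrightarrow> (\<Sum>j\<in>UNIV. x $ j * \<eta> $ j / sqrt ((x $ j)\<^sup>2 + e\<^sup>2)) = 0"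
  shows "f_eps e x < f_eps e z"
proof -
  obtain i where i: "x $ i \<noteq> z $ i" using \<open>z \<noteq> x\<close> by (metis vec_eq_iff)
  let ?t = "\<lambda>j. sqrt ((x $ j)\<^sup>2 + e\<^sup>2) + x $ j * (z $ j - x $ j) / sqrt ((x $ j)\<^sup>2 + e\<^sup>2)"
  have le: "?t j \<le> sqrt ((z $ j)\<^sup>2 + e\<^sup>2)" for j
    using sqrt_tangent_less[OF \<open>0 < e\<close>, of "x $ j" "z $ j"]
    by (cases "x $ j = z $ j") auto
  have "f_eps e x = (\<Sum>j\<in>UNIV. ?t j)"
    using crit[OF feasible_diff[OF feas(2,1)]] by (simp add: sum.distrib f_eps_def)
  also have "\<dots> < f_eps e z"
    unfolding f_eps_def
    by (rule sum_strict_mono_ex1) (use le sqrt_tangent_less[OF \<open>0 < e\<close> i] in auto)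
  finally show ?thesis .
qed

text \<open>
Concavity of the square root as a function of the squared argument. The slope \<open>1 / (2 * sqrt (x\<^sup>2 + e\<^sup>2))\<close>
at \<open>x\<close> is half the weight that the algorithm assigns to the entry \<open>x\<close>; this is what makes
the reweighted quadratic a majorant of \<open>f_eps e\<close>.
\<close>

lemma sqrt_concave_bound:
  fixes x z e :: real
  assumes "0 < e"
  shows "sqrt (z\<^sup>2 + e\<^sup>2) \<le> sqrt (x\<^sup>2 + e\<^sup>2) + (z\<^sup>2 - x\<^sup>2) / sqrt (x\<^sup>2 + e\<^sup>2) / 2"
proof -
  define a b where "a = sqrt (x\<^sup>2 + e\<^sup>2)" and "b = sqrt (z\<^sup>2 + e\<^sup>2)"
  have a: "0 < a" using assms by (simp add: a_def add_nonneg_pos)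
  have sq: "z\<^sup>2 - x\<^sup>2 = b\<^sup>2 - a\<^sup>2" by (simp add: a_def b_def)
  have "a + (b\<^sup>2 - a\<^sup>2) / a / 2 - b = (b - a)\<^sup>2 / (2 * a)"
    using a by (simp add: field_simps power2_eq_square)
  moreover have "0 \<le> (b - a)\<^sup>2 / (2 * a)" using a by simp
  ultimately show ?thesis unfolding a_def[symmetric] b_def[symmetric] sq by linarith
qed

section \<open>Sequences with a single cluster point\<close>

text \<open>
If the sequence did not converge to \<open>a\<close>, infinitely many terms would avoid a neighbourhood of
\<open>a\<close>, and a cluster point of these terms would differ from \<open>a\<close>.
\<close>

lemma bounded_unique_cluster_tendsto:
  fixes X :: "nat \<Rightarrow> 'a::heine_borel"
  assumes bdd: "bounded (range X)"
    and unique: "\<And>s l. strict_mono (s :: nat \<Rightarrow> nat) \<Longrightarrow> (X \<circ> s) \<longlonglongrightarrow> l \<Longrightarrow> l = a"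
  shows "X \<longlonglongrightarrow> a"
proof (rule ccontr)
  assume "\<not> X \<longlonglongrightarrow> a"
  then obtain U where U: "open U" "a \<in> U" "\<not> (\<forall>\<^sub>F n in sequentially. X n \<in> U)"
    by (auto simp: tendsto_def)
  then have inf: "infinite {n. X n \<notin> U}"
    by (simp add: cofinite_eq_sequentially[symmetric] eventually_cofinite)
  define s where "s = enumerate {n. X n \<notin> U}"
  have s: "strict_mono s" unfolding s_def using inf by (rule strict_mono_enumerate)
  have out: "X (s n) \<notin> U" for n using enumerate_in_set[OF inf, of n] by (simp add: s_def)
  have "bounded (range (X \<circ> s))" by (rule bounded_subset[OF bdd]) auto
  then obtain l r where r: "strict_mono (r :: nat \<Rightarrow> nat)" "((X \<circ> s) \<circ> r) \<longlonglongrightarrow> l"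
    using bounded_imp_convergent_subsequence by blast
  have "l = a" using unique[of "s \<circ> r" l] r s by (simp add: strict_mono_o o_assoc)
  then have "\<forall>\<^sub>F n in sequentially. X (s (r n)) \<in> U" using r(2) U by (auto simp: tendsto_def)
  then show False using out by simp
qed

section \<open>The iteration\<close>

context
  fixes \<Phi> :: "real^'n^'m" and y :: "real^'m" and K :: nat
  assumes solvable: "feasible \<Phi> y \<noteq> {}" and K: "K < CARD('n)"
begin

abbreviation (input) "X \<equiv> irls_x \<Phi> y K"
abbreviation (input) "E \<equiv> irls_eps \<Phi> y K"

definition weight :: "nat \<Rightarrow> real^'n" where
  "weight n = (\<chi> j. 1 / sqrt ((X n $ j)\<^sup>2 + (E n)\<^sup>2))"

lemma irls_0: "X 0 = 0" "E 0 = 1"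
  by (simp_all add: irls_x_def irls_eps_def)

text \<open>
The initial state \<open>(0, 1, (1, ..., 1))\<close> already has the weights that belong to its first two
components, and a stopped state does not change; hence the weights are a function of the iterate and
of \<open>\<epsilon>\<close> at every step and can be dropped from the state.
\<close>

lemma irls_weight: "snd (snd (irls \<Phi> y K n)) = weight n"
proof (induction n)
  case 0
  then show ?case by (simp add: weight_def irls_0 vec_eq_iff)
next
  case (Suc n)
  obtain x e w where s: "irls \<Phi> y K n = (x, e, w)" by (metis prod_cases3)
  \<comment> \<open>At \<open>a = 0\<close> both sides are 0 by convention; a stopped run can produce this case.\<close>
  have powr: "a powr - (1 / 2) = 1 / sqrt a" if "0 \<le> a" for a :: real
    using that powr_half_sqrt[of a] by (simp add: powr_minus_divide)
  show ?case
  proof (cases "e = 0")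
    case True
    then have "irls \<Phi> y K (Suc n) = irls \<Phi> y K n" by (simp add: s irls_step_def)
    then show ?thesis using Suc by (simp add: weight_def irls_x_def irls_eps_def)
  next
    case False
    then show ?thesis
      by (simp add: s irls_step_def weight_def irls_x_def irls_eps_def Let_def powr vec_eq_iff)
  qed
qed

lemma irls_stopped:
  assumes "E n = 0"
  shows "X (Suc n) = X n" "E (Suc n) = 0"
proof -
  obtain x e w where s: "irls \<Phi> y K n = (x, e, w)" by (metis prod_cases3)
  then show "X (Suc n) = X n" "E (Suc n) = 0"
    using assms by (simp_all add: irls_x_def irls_eps_def irls_step_def)
qed

lemma rearr_K_nonneg: "0 \<le> rearr z (K + 1)" for z :: "real^'n"
  using K by (intro rearr_nonneg) auto

lemma irls_running:
  assumes "E n \<noteq> 0"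
  shows "E (Suc n) = min (E n) (rearr (X (Suc n)) (K + 1) / real CARD('n))"
    and "X (Suc n) = (ARG_MIN (\<lambda>z. \<Sum>j\<in>UNIV. weight n $ j * (z $ j)\<^sup>2) z. z \<in> feasible \<Phi> y)"
proof -
  obtain x e w where s: "irls \<Phi> y K n = (x, e, w)" by (metis prod_cases3)
  then have w: "w = weight n" using irls_weight[of n] by simp
  show "E (Suc n) = min (E n) (rearr (X (Suc n)) (K + 1) / real CARD('n))"
    and "X (Suc n) = (ARG_MIN (\<lambda>z. \<Sum>j\<in>UNIV. weight n $ j * (z $ j)\<^sup>2) z. z \<in> feasible \<Phi> y)"
    using assms s w by (simp_all add: irls_x_def irls_eps_def irls_step_def Let_def)
qed

lemma irls_eps_nonneg: "0 \<le> E n"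
proof (induction n)
  case 0 show ?case by (simp add: irls_0)
next
  case (Suc n)
  then show ?case
    using irls_running(1)[of n] irls_stopped(2)[of n] rearr_K_nonneg[of "X (Suc n)"]
    by (cases "E n = 0") auto
qed

lemma irls_eps_Suc_le: "E (Suc n) \<le> E n"
  using irls_running(1)[of n] irls_stopped(2)[of n] by (cases "E n = 0") auto

lemma irls_eps_le_rearr: "real CARD('n) * E (Suc n) \<le> rearr (X (Suc n)) (K + 1)"
proof (cases "E n = 0")
  case True
  then show ?thesis using irls_stopped(2)[of n] rearr_K_nonneg by simp
next
  case False
  then have "E (Suc n) \<le> rearr (X (Suc n)) (K + 1) / real CARD('n)"
    using irls_running(1) by simp
  then show ?thesis by (simp add: field_simps)
qed

text \<open>
The parameter is a running minimum that starts at 1, so any smaller value has been read off the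
rearrangement of some iterate and kept since.
\<close>

lemma irls_eps_attained: "E n < 1 \<Longrightarrow> \<exists>m. rearr (X (Suc m)) (K + 1) = real CARD('n) * E n"
proof (induction n)
  case 0 then show ?case by (simp add: irls_0)
next
  case (Suc n)
  show ?case
  proof (cases "E (Suc n) = E n")
    case True then show ?thesis using Suc by simp
  next
    case False
    then have "E n \<noteq> 0" using irls_stopped(2)[of n] by auto
    from irls_running(1)[OF this] False
    have "E (Suc n) = rearr (X (Suc n)) (K + 1) / real CARD('n)" by linarith
    then show ?thesis by (intro exI[of _ n]) (simp add: field_simps)
  qed
qed

lemma weight_pos: "E n \<noteq> 0 \<Longrightarrow> 0 < weight n $ j"
  by (simp add: weight_def add_nonneg_pos)

lemma irls_arg_min:
  assumes "E n \<noteq> 0"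
  shows "is_arg_min (\<lambda>z. \<Sum>j\<in>UNIV. weight n $ j * (z $ j)\<^sup>2) (\<lambda>z. z \<in> feasible \<Phi> y) (X (Suc n))"
  unfolding irls_running(2)[OF assms] arg_min_def
  by (rule someI_ex) (rule weighted_ls_minimizer_exists[OF weight_pos[OF assms] solvable])

lemma irls_feasible: "X (Suc n) \<in> feasible \<Phi> y"
proof (induction n)
  case 0
  then show ?case using irls_arg_min[of 0] by (simp add: irls_0 is_arg_min_def)
next
  case (Suc n)
  then show ?case
    using irls_arg_min[of "Suc n"] irls_stopped(1)[of "Suc n"]
    by (cases "E (Suc n) = 0") (auto simp: is_arg_min_def)
qed

lemma irls_orthogonal:
  assumes "E n \<noteq> 0" "\<Phi> *v \<eta> = 0"
  shows "(\<Sum>j\<in>UNIV. weight n $ j * X (Suc n) $ j * \<eta> $ j) = 0"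
  by (rule weighted_ls_orthogonal[OF weight_pos[OF assms(1)] irls_arg_min[OF assms(1)] assms(2)])

text \<open>
The concavity bound turns the change of the energy into half the change of the weighted quadratic
form. By the normal equations the step is orthogonal to the new iterate in the weighted inner product,
so Pythagoras identifies the decrease of the quadratic form with the weighted square length of the
step. The indices start at 1 because the state at 0 carries a vector that is not feasible in general.
\<close>

lemma irls_energy_drop:
  assumes e: "E (Suc n) \<noteq> 0"
  shows "f_eps (E (Suc (Suc n))) (X (Suc (Suc n)))
      + (\<Sum>j\<in>UNIV. weight (Suc n) $ j * (X (Suc n) $ j - X (Suc (Suc n)) $ j)\<^sup>2) / 2
    \<le> f_eps (E (Suc n)) (X (Suc n))"
proof -
  define x x' w where "x = X (Suc n)" and "x' = X (Suc (Suc n))" and "w = weight (Suc n)"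
  have pos: "0 < E (Suc n)" using e irls_eps_nonneg[of "Suc n"] by simp
  have "f_eps (E (Suc (Suc n))) x' \<le> f_eps (E (Suc n)) x'"
    unfolding f_eps_def
    by (rule sum_mono) (simp add: irls_eps_Suc_le irls_eps_nonneg power_mono)
  also have "\<dots> \<le> (\<Sum>j\<in>UNIV. sqrt ((x $ j)\<^sup>2 + (E (Suc n))\<^sup>2) + w $ j * ((x' $ j)\<^sup>2 - (x $ j)\<^sup>2) / 2)"
    unfolding f_eps_def
    by (rule sum_mono) (use sqrt_concave_bound[OF pos] in \<open>simp add: w_def weight_def x_def\<close>)
  also have "\<dots> = f_eps (E (Suc n)) x + (\<Sum>j\<in>UNIV. w $ j * ((x' $ j)\<^sup>2 - (x $ j)\<^sup>2)) / 2"
    by (simp add: sum.distrib f_eps_def sum_divide_distrib)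
  also have "(\<Sum>j\<in>UNIV. w $ j * ((x' $ j)\<^sup>2 - (x $ j)\<^sup>2))
      = - (\<Sum>j\<in>UNIV. w $ j * (x $ j - x' $ j)\<^sup>2) - 2 * (\<Sum>j\<in>UNIV. w $ j * x' $ j * (x - x') $ j)"
    unfolding sum_distrib_left sum_negf[symmetric] sum_subtractf[symmetric]
    by (rule sum.cong) (simp_all add: power2_eq_square algebra_simps)
  also have "(\<Sum>j\<in>UNIV. w $ j * x' $ j * (x - x') $ j) = 0"
    unfolding w_def x'_def x_def
    by (rule irls_orthogonal[OF e feasible_diff[OF irls_feasible irls_feasible]])
  finally show ?thesis by (simp add: x_def x'_def w_def)
qed

lemma irls_energy_decreasing:
  "f_eps (E (Suc (Suc n))) (X (Suc (Suc n))) \<le> f_eps (E (Suc n)) (X (Suc n))"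
proof (cases "E (Suc n) = 0")
  case True
  then show ?thesis using irls_stopped[OF True] by simp
next
  case False
  have "0 \<le> (\<Sum>j\<in>UNIV. weight (Suc n) $ j * (X (Suc n) $ j - X (Suc (Suc n)) $ j)\<^sup>2)"
    by (rule sum_nonneg) (use weight_pos[OF False] in \<open>simp add: less_imp_le\<close>)
  then show ?thesis using irls_energy_drop[OF False] by linarith
qed

lemma decseq_irls_energy: "decseq (\<lambda>n. f_eps (E (Suc n)) (X (Suc n)))"
  by (rule decseq_SucI) (rule irls_energy_decreasing)

lemma irls_l1_bound: "l1norm (X (Suc n)) \<le> f_eps (E 1) (X 1)"
  using l1norm_le_f_eps[of "X (Suc n)" "E (Suc n)"] decseqD[OF decseq_irls_energy, of 0 n] by simp

lemma bounded_irls: "bounded (range (\<lambda>n. X (Suc n)))"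
  unfolding bounded_iff
  using order_trans[OF norm_le_l1norm irls_l1_bound] by auto

lemma irls_eps_convergent:
  obtains \<epsilon> where "E \<longlonglongrightarrow> \<epsilon>" "0 \<le> \<epsilon>" "\<And>n. \<epsilon> \<le> E n"
proof -
  have dec: "decseq E" by (rule decseq_SucI) (rule irls_eps_Suc_le)
  obtain \<epsilon> where \<epsilon>: "E \<longlonglongrightarrow> \<epsilon>"
    by (rule decseq_convergent[OF dec, of 0]) (use irls_eps_nonneg in auto)
  show thesis
  proof (rule that[OF \<epsilon>])
    show "0 \<le> \<epsilon>" by (rule LIMSEQ_le_const[OF \<epsilon>]) (use irls_eps_nonneg in blast)
    show "\<epsilon> \<le> E n" for n by (rule decseq_ge[OF dec \<epsilon>])
  qed
qed

text \<open>
The drops of a convergent energy tend to zero. They dominate the weighted square lengths of the steps,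
and each weight is at least the reciprocal of the energy after the first step, because
\<open>sqrt (x_j\<^sup>2 + \<epsilon>\<^sup>2)\<close> is one of the summands of the energy.
\<close>

lemma irls_steps_vanish:
  assumes "\<And>n. E n \<noteq> 0"
  shows "(\<lambda>n. X (Suc n) - X (Suc (Suc n))) \<longlonglongrightarrow> 0"
proof -
  define F where "F = (\<lambda>n. f_eps (E (Suc n)) (X (Suc n)))"
  have F0: "0 \<le> F n" for n
    unfolding F_def using l1norm_le_f_eps l1norm_nonneg order_trans by blast
  obtain l where l: "F \<longlonglongrightarrow> l"
    by (rule decseq_convergent[OF decseq_irls_energy[folded F_def], of 0]) (use F0 in auto)
  have drop: "(\<lambda>n. F n - F (Suc n)) \<longlonglongrightarrow> 0"
    using tendsto_diff[OF l LIMSEQ_Suc[OF l]] by simp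
  have sq: "(X (Suc n) $ j - X (Suc (Suc n)) $ j)\<^sup>2 \<le> 2 * F 0 * (F n - F (Suc n))" for n j
  proof -
    define d where "d = (X (Suc n) $ j - X (Suc (Suc n)) $ j)\<^sup>2"
    define s where "s = sqrt ((X (Suc n) $ j)\<^sup>2 + (E (Suc n))\<^sup>2)"
    have s: "0 < s" using weight_pos[OF assms, of "Suc n" j] by (simp add: s_def weight_def)
    have "s \<le> F n" unfolding s_def F_def f_eps_def by (rule member_le_sum) auto
    also have "\<dots> \<le> F 0" using decseqD[OF decseq_irls_energy, of 0 n] by (simp add: F_def)
    finally have sF: "s \<le> F 0" .
    have "weight (Suc n) $ j * d
        \<le> (\<Sum>j\<in>UNIV. weight (Suc n) $ j * (X (Suc n) $ j - X (Suc (Suc n)) $ j)\<^sup>2)"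
      unfolding d_def by (rule member_le_sum) (use weight_pos[OF assms] in \<open>simp_all add: less_imp_le\<close>)
    also have "\<dots> \<le> 2 * (F n - F (Suc n))"
      using irls_energy_drop[OF assms, of n] by (simp add: F_def)
    finally have "d / s \<le> 2 * (F n - F (Suc n))" by (simp add: weight_def s_def)
    then have "d \<le> s * (2 * (F n - F (Suc n)))" using s by (simp add: pos_divide_le_eq mult.commute)
    also have "\<dots> \<le> F 0 * (2 * (F n - F (Suc n)))"
      using decseqD[OF decseq_irls_energy, of n "Suc n"]
      by (intro mult_right_mono sF) (simp add: F_def)
    finally show ?thesis by (simp add: d_def mult_ac)
  qed
  have "(\<lambda>n. (X (Suc n) - X (Suc (Suc n))) $ j) \<longlonglongrightarrow> 0 $ j" for j
  proof -
    have "(\<lambda>n. 2 * F 0 * (F n - F (Suc n))) \<longlonglongrightarrow> 0"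
      using tendsto_mult_right_zero[OF drop] by simp
    then have "(\<lambda>n. (X (Suc n) $ j - X (Suc (Suc n)) $ j)\<^sup>2) \<longlonglongrightarrow> 0"
      by (rule Lim_null_comparison[OF always_eventually, rotated]) (use sq in simp)
    from tendsto_real_sqrt[OF this] show ?thesis by (simp add: tendsto_rabs_zero_iff)
  qed
  then show ?thesis by (rule vec_tendstoI)
qed

text \<open>
Since the steps vanish, an iterate and its successor converge to the same point along the subsequence.
The normal equations combine the weights of the first with the entries of the second, and pass to the
limit as the stationarity condition for \<open>f_eps \<epsilon>\<close>.
\<close>

lemma irls_cluster_critical:
  assumes \<epsilon>: "E \<longlonglongrightarrow> \<epsilon>" "0 < \<epsilon>" "\<And>n. \<epsilon> \<le> E n"
    and s: "strict_mono (s :: nat \<Rightarrow> nat)" and l: "((\<lambda>n. X (Suc n)) \<circ> s) \<longlonglongrightarrow> l"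
  shows "l \<in> feasible \<Phi> y"
    and "\<Phi> *v \<eta> = 0 \<Longrightarrow> (\<Sum>j\<in>UNIV. l $ j * \<eta> $ j / sqrt ((l $ j)\<^sup>2 + \<epsilon>\<^sup>2)) = 0"
proof -
  show "l \<in> feasible \<Phi> y"
    by (rule closed_sequentially[OF closed_feasible _ l]) (use irls_feasible in auto)
  assume \<eta>: "\<Phi> *v \<eta> = 0"
  have nz: "E n \<noteq> 0" for n using \<epsilon>(2) \<epsilon>(3)[of n] by simp
  have l1: "(\<lambda>i. X (Suc (s i))) \<longlonglongrightarrow> l" using l by (simp add: o_def)
  have "(\<lambda>i. X (Suc (s i)) - X (Suc (Suc (s i)))) \<longlonglongrightarrow> 0"
    using LIMSEQ_subseq_LIMSEQ[OF irls_steps_vanish[OF nz] s] by (simp add: o_def)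
  from tendsto_diff[OF l1 this] have l2: "(\<lambda>i. X (Suc (Suc (s i)))) \<longlonglongrightarrow> l" by simp
  have e: "(\<lambda>i. E (Suc (s i))) \<longlonglongrightarrow> \<epsilon>"
    using LIMSEQ_subseq_LIMSEQ[OF LIMSEQ_Suc[OF \<epsilon>(1)] s] by (simp add: o_def)
  have nz': "sqrt ((l $ j)\<^sup>2 + \<epsilon>\<^sup>2) \<noteq> 0" for j
    using \<epsilon>(2) by (simp add: sum_power2_eq_zero_iff)
  have "(\<lambda>i. \<Sum>j\<in>UNIV. X (Suc (Suc (s i))) $ j * \<eta> $ j
        / sqrt ((X (Suc (s i)) $ j)\<^sup>2 + (E (Suc (s i)))\<^sup>2))
      \<longlonglongrightarrow> (\<Sum>j\<in>UNIV. l $ j * \<eta> $ j / sqrt ((l $ j)\<^sup>2 + \<epsilon>\<^sup>2))"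
    by (intro tendsto_intros l1 l2 e nz')
  moreover have "(\<Sum>j\<in>UNIV. X (Suc (Suc n)) $ j * \<eta> $ j
      / sqrt ((X (Suc n) $ j)\<^sup>2 + (E (Suc n))\<^sup>2)) = 0" for n
    using irls_orthogonal[OF nz[of "Suc n"] \<eta>] by (simp add: weight_def mult_ac)
  ultimately show "(\<Sum>j\<in>UNIV. l $ j * \<eta> $ j / sqrt ((l $ j)\<^sup>2 + \<epsilon>\<^sup>2)) = 0"
    by (simp add: LIMSEQ_const_iff)
qed

text \<open>
Two distinct cluster points would each have a strictly smaller value of \<open>f_eps \<epsilon>\<close> than the other.
\<close>

lemma irls_converges_pos:
  assumes \<epsilon>: "E \<longlonglongrightarrow> \<epsilon>" "0 < \<epsilon>" "\<And>n. \<epsilon> \<le> E n"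
  obtains x where "X \<longlonglongrightarrow> x" "x \<in> feasible \<Phi> y"
    "\<And>z. z \<in> feasible \<Phi> y \<Longrightarrow> z \<noteq> x \<Longrightarrow> f_eps \<epsilon> x < f_eps \<epsilon> z"
proof -
  obtain x r where r: "strict_mono (r :: nat \<Rightarrow> nat)" "((\<lambda>n. X (Suc n)) \<circ> r) \<longlonglongrightarrow> x"
    using bounded_imp_convergent_subsequence[OF bounded_irls] by blast
  note crit = irls_cluster_critical[OF \<epsilon>]
  have less: "f_eps \<epsilon> l < f_eps \<epsilon> z"
    if "strict_mono s" "((\<lambda>n. X (Suc n)) \<circ> s) \<longlonglongrightarrow> l" "z \<in> feasible \<Phi> y" "z \<noteq> l" for s l z
    using f_eps_critical_less[OF \<epsilon>(2) crit(1)[OF that(1,2)] that(3,4) crit(2)[OF that(1,2)]] .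
  have "(\<lambda>n. X (Suc n)) \<longlonglongrightarrow> x"
  proof (rule bounded_unique_cluster_tendsto[OF bounded_irls], rule ccontr)
    fix s :: "nat \<Rightarrow> nat" and l
    assume s: "strict_mono s" "((\<lambda>n. X (Suc n)) \<circ> s) \<longlonglongrightarrow> l" and "l \<noteq> x"
    then show False
      using less[OF s crit(1)[OF r]] less[OF r crit(1)[OF s]] by auto
  qed
  then have "X \<longlonglongrightarrow> x" by (simp add: filterlim_sequentially_Suc)
  then show thesis using that crit(1)[OF r] less[OF r] by blast
qed

text \<open>
A cluster point of iterates whose \<open>(K+1)\<close>-st largest entry tends to zero is \<open>K\<close>-sparse, hence
the l1 minimizer \<open>x\<close>. The selected iterates need not have increasing indices, so convergence of the
whole sequence comes from the energy: it is decreasing, at least the l1 norm, and comes arbitrarily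
close to the l1 norm of \<open>x\<close>. Thus the l1 norms of all late iterates are close to the minimum, and
the null space property converts this into closeness to \<open>x\<close>. The argument covers a run that stops
as well as one that does not.
\<close>

lemma irls_converges_zero:
  assumes \<epsilon>: "E \<longlonglongrightarrow> 0" and nsp: "null_space_property \<Phi> K \<gamma>" "\<gamma> < 1"
  obtains x where "X \<longlonglongrightarrow> x" "x \<in> feasible \<Phi> y" "rearr x (K + 1) = 0" "k_sparse K x"
proof -
  define N where "N = real CARD('n)"
  have N0: "0 < N" by (simp add: N_def)
  have "\<exists>m. rearr (X (Suc m)) (K + 1) < inverse (real (Suc i))" for i
  proof -
    have "\<forall>\<^sub>F n in sequentially. E n < min 1 (inverse (real (Suc i)) / N)"
      by (rule order_tendstoD(2)[OF \<epsilon>]) (use N0 in auto)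
    then obtain n where n: "E n < 1" "E n < inverse (real (Suc i)) / N"
      by (auto simp: eventually_sequentially)
    from irls_eps_attained[OF n(1)] obtain m where "rearr (X (Suc m)) (K + 1) = N * E n"
      by (auto simp: N_def)
    also have "\<dots> < inverse (real (Suc i))"
      using n(2) N0 by (simp only: pos_less_divide_eq mult.commute)
    finally show ?thesis by blast
  qed
  then obtain m where m: "\<And>i. rearr (X (Suc (m i))) (K + 1) < inverse (real (Suc i))"
    by metis
  have "bounded (range (\<lambda>i. X (Suc (m i))))" by (rule bounded_subset[OF bounded_irls]) auto
  then obtain x r where r: "strict_mono (r :: nat \<Rightarrow> nat)" "((\<lambda>i. X (Suc (m i))) \<circ> r) \<longlonglongrightarrow> x"
    using bounded_imp_convergent_subsequence by blast
  define p where "p = (\<lambda>i. Suc (m (r i)))"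
  have p: "(\<lambda>i. X (p i)) \<longlonglongrightarrow> x" using r(2) by (simp add: o_def p_def)
  have "(\<lambda>i. rearr (X (Suc (m i))) (K + 1)) \<longlonglongrightarrow> 0"
    by (rule Lim_null_comparison[OF always_eventually LIMSEQ_inverse_real_of_nat])
      (use m rearr_K_nonneg less_imp_le in auto)
  from LIMSEQ_subseq_LIMSEQ[OF this r(1)]
  have rp: "(\<lambda>i. rearr (X (p i)) (K + 1)) \<longlonglongrightarrow> 0" by (simp add: o_def p_def)
  have rx: "rearr x (K + 1) = 0"
    by (rule LIMSEQ_unique[OF tendsto_rearr[OF _ _ p] rp]) (use K in auto)
  have sparse: "k_sparse K x" by (rule rearr_eq_0_imp_sparse[OF K rx])
  have feas: "x \<in> feasible \<Phi> y"
    by (rule closed_sequentially[OF closed_feasible _ p]) (use irls_feasible p_def in auto)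
  note l1 = sparse_l1_distance[OF nsp feas sparse] sparse_l1_le[OF nsp feas sparse]
  have lim: "(\<lambda>i. l1norm (X (p i)) + rearr (X (p i)) (K + 1)) \<longlonglongrightarrow> l1norm x + 0"
    by (intro tendsto_add rp continuous_on_tendsto_compose[OF continuous_l1norm p]) auto
  have "(\<lambda>n. l1norm (X (Suc n)) - l1norm x) \<longlonglongrightarrow> 0"
  proof (rule LIMSEQ_I)
    fix \<delta> :: real assume "0 < \<delta>"
    then have "\<forall>\<^sub>F i in sequentially. l1norm (X (p i)) + rearr (X (p i)) (K + 1) < l1norm x + \<delta>"
      using order_tendstoD(2)[OF lim, of "l1norm x + \<delta>"] by simp
    then obtain i where i: "l1norm (X (p i)) + rearr (X (p i)) (K + 1) < l1norm x + \<delta>"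
      by (auto simp: eventually_sequentially)
    show "\<exists>n0. \<forall>n\<ge>n0. norm (l1norm (X (Suc n)) - l1norm x - 0) < \<delta>"
    proof (intro exI allI impI)
      fix n assume n: "m (r i) \<le> n"
      have "l1norm (X (Suc n)) \<le> f_eps (E (Suc n)) (X (Suc n))" by (rule l1norm_le_f_eps)
      also have "\<dots> \<le> f_eps (E (p i)) (X (p i))"
        using decseqD[OF decseq_irls_energy n] by (simp add: p_def)
      also have "\<dots> \<le> l1norm (X (p i)) + N * E (p i)"
        unfolding N_def by (rule f_eps_le_l1norm[OF irls_eps_nonneg])
      also have "\<dots> \<le> l1norm (X (p i)) + rearr (X (p i)) (K + 1)"
        unfolding N_def p_def using irls_eps_le_rearr by simp
      also note i
      finally show "norm (l1norm (X (Suc n)) - l1norm x - 0) < \<delta>"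
        using l1(2)[OF irls_feasible[of n]] by simp
    qed
  qed
  then have "(\<lambda>n. (1 + \<gamma>) / (1 - \<gamma>) * (l1norm (X (Suc n)) - l1norm x)) \<longlonglongrightarrow> 0"
    by (rule tendsto_mult_right_zero)
  moreover have "\<forall>n. norm (X (Suc n) - x) \<le> (1 + \<gamma>) / (1 - \<gamma>) * (l1norm (X (Suc n)) - l1norm x)"
    by (intro allI) (rule order_trans[OF norm_le_l1norm l1(1)[OF irls_feasible]])
  ultimately have "(\<lambda>n. X (Suc n) - x) \<longlonglongrightarrow> 0"
    by (rule Lim_null_comparison[OF always_eventually, rotated])
  then have "(\<lambda>n. X (Suc n)) \<longlonglongrightarrow> x" by (rule LIM_zero_cancel)
  then have "X \<longlonglongrightarrow> x" by (rule LIMSEQ_imp_Suc)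
  from that[OF this feas rx sparse] show thesis .
qed

text \<open>
Both parts pass \<open>N * E n \<le> rearr (X n) (K + 1)\<close> to the limit: the difference of the two sides
is nonnegative, and a convergent sequence that vanishes infinitely often has limit zero.
\<close>

lemma irls_limit_rearr:
  assumes "X \<longlonglongrightarrow> x" "E \<longlonglongrightarrow> \<epsilon>"
  shows irls_limit_rearr_ge: "real CARD('n) * \<epsilon> \<le> rearr x (K + 1)"
    and irls_limit_rearr_eq:
      "\<exists>\<^sub>\<infinity>n. eps_from_iterate \<Phi> y K n \<Longrightarrow> rearr x (K + 1) = real CARD('n) * \<epsilon>"
proof -
  have "(\<lambda>n. rearr (X (Suc n)) (K + 1)) \<longlonglongrightarrow> rearr x (K + 1)"
    by (rule tendsto_rearr[OF _ _ LIMSEQ_Suc[OF assms(1)]]) (use K in auto)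
  then have lim: "(\<lambda>n. rearr (X (Suc n)) (K + 1) - real CARD('n) * E (Suc n))
      \<longlonglongrightarrow> rearr x (K + 1) - real CARD('n) * \<epsilon>"
    by (intro tendsto_intros LIMSEQ_Suc[OF assms(2)])
  have "0 \<le> rearr x (K + 1) - real CARD('n) * \<epsilon>"
    by (rule LIMSEQ_le_const[OF lim]) (use irls_eps_le_rearr in auto)
  then show "real CARD('n) * \<epsilon> \<le> rearr x (K + 1)" by linarith
  assume inf: "\<exists>\<^sub>\<infinity>n. eps_from_iterate \<Phi> y K n"
  show "rearr x (K + 1) = real CARD('n) * \<epsilon>"
  proof (rule ccontr)
    assume "rearr x (K + 1) \<noteq> real CARD('n) * \<epsilon>"
    then have "\<forall>\<^sub>F n in sequentially. rearr (X (Suc n)) (K + 1) - real CARD('n) * E (Suc n) \<noteq> 0"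
      by (intro tendsto_imp_eventually_ne[OF lim]) simp
    then have "\<forall>\<^sub>F n in sequentially. \<not> eps_from_iterate \<Phi> y K n"
      by (rule eventually_mono) (auto simp: eps_from_iterate_def)
    then show False
      using inf by (simp add: frequently_def cofinite_eq_sequentially)
  qed
qed

end

section \<open>Error bounds for the limit\<close>

text \<open>
Write \<open>a = 2 * \<gamma> / (1 - \<gamma>)\<close>, so that \<open>(1 + \<gamma>) / (1 - \<gamma>) = 1 + a\<close>, and
\<open>e = N * \<epsilon>\<close>. Minimality and the comparison of \<open>f_eps \<epsilon>\<close> with the l1 norm show that
\<open>x\<close> exceeds \<open>z\<close> in l1 norm by at most \<open>e\<close>, so the distance is at most
\<open>(1 + a) * (e + 2 * \<sigma>)\<close>. Conversely \<open>(K + 1 - k) * e\<close> is at most the distance plus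
\<open>\<sigma>\<close> by \<open>rearr_le_l1_sigma\<close>. Eliminating the distance leaves
\<open>(K - k - a) * e \<le> (3 + 2 * a) * \<sigma>\<close>, which bounds \<open>e\<close> and thereby the distance. The first
part is kept as a statement of its own because it shows \<open>\<epsilon> \<le> 0\<close> when \<open>z\<close> is
\<open>k\<close>-sparse.
\<close>

lemma f_eps_minimizer_error:
  fixes \<Phi> :: "real^'n^'m"
  assumes nsp: "null_space_property \<Phi> K \<gamma>" "\<gamma> < 1" and K: "K < CARD('n)"
    and \<epsilon>: "0 \<le> \<epsilon>" "real CARD('n) * \<epsilon> \<le> rearr x (K + 1)"
    and x: "x \<in> feasible \<Phi> y" "f_eps \<epsilon> x \<le> f_eps \<epsilon> z"
    and z: "z \<in> feasible \<Phi> y" and k: "real k < real K - 2 * \<gamma> / (1 - \<gamma>)"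
  shows f_eps_minimizer_eps_le:
      "real CARD('n) * \<epsilon> * (real K - real k - 2 * \<gamma> / (1 - \<gamma>))
        \<le> (3 + 4 * \<gamma> / (1 - \<gamma>)) * sigma_l1 k z"
    and f_eps_minimizer_l1_error:
      "l1norm (z - x) \<le> 2 * (1 + \<gamma>) / (1 - \<gamma>) *
        ((real K - real k + 3 / 2) / (real K - real k - 2 * \<gamma> / (1 - \<gamma>))) * sigma_l1 k z"
proof -
  define a where "a = 2 * \<gamma> / (1 - \<gamma>)"
  define \<sigma> where "\<sigma> = sigma_l1 k z"
  define e where "e = real CARD('n) * \<epsilon>"
  define D where "D = real K - real k - a"
  have \<gamma>0: "0 < \<gamma>" using nsp by (simp add: null_space_property_def)
  have c: "(1 + \<gamma>) / (1 - \<gamma>) = 1 + a" using nsp(2) by (simp add: a_def field_simps)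
  have a0: "0 < a" using \<gamma>0 nsp(2) by (simp add: a_def)
  have D0: "0 < D" using k by (simp add: D_def a_def)
  have kK: "k \<le> K" using D0 a0 by (simp add: D_def)
  have "l1norm x \<le> f_eps \<epsilon> x" by (rule l1norm_le_f_eps)
  also note x(2)
  also have "f_eps \<epsilon> z \<le> l1norm z + e" unfolding e_def by (rule f_eps_le_l1norm[OF \<epsilon>(1)])
  finally have "l1norm x - l1norm z + 2 * \<sigma> \<le> e + 2 * \<sigma>" by simp
  then have "(1 + a) * (l1norm x - l1norm z + 2 * \<sigma>) \<le> (1 + a) * (e + 2 * \<sigma>)"
    using a0 by (intro mult_left_mono) auto
  with null_space_l1_estimate[OF nsp z x(1) kK]
  have err: "l1norm (x - z) \<le> (1 + a) * (e + 2 * \<sigma>)" by (simp add: c \<sigma>_def)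
  have "(real (K + 1) - real k) * e \<le> (real (K + 1) - real k) * rearr x (K + 1)"
    using kK \<epsilon>(2) by (intro mult_left_mono) (auto simp: e_def)
  also have "\<dots> \<le> l1norm (x - z) + \<sigma>"
    unfolding \<sigma>_def by (rule rearr_le_l1_sigma) (use K kK in auto)
  also note err
  finally have main: "e * D \<le> (3 + 2 * a) * \<sigma>" by (simp add: D_def algebra_simps)
  then show "real CARD('n) * \<epsilon> * (real K - real k - 2 * \<gamma> / (1 - \<gamma>))
        \<le> (3 + 4 * \<gamma> / (1 - \<gamma>)) * sigma_l1 k z"
    by (simp add: e_def D_def a_def \<sigma>_def)
  define q where "q = real K - real k + 3 / 2"
  have "(e + 2 * \<sigma>) * D \<le> 2 * q * \<sigma>"
    using main by (simp add: D_def q_def algebra_simps)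
  then have "e + 2 * \<sigma> \<le> 2 * q * \<sigma> / D"
    using D0 by (simp add: pos_le_divide_eq)
  then have "(1 + a) * (e + 2 * \<sigma>) \<le> (1 + a) * (2 * q * \<sigma> / D)"
    using a0 by (intro mult_left_mono) auto
  also have "\<dots> = 2 * ((1 + \<gamma>) / (1 - \<gamma>)) * (q / D) * \<sigma>"
    unfolding c by (simp add: mult_ac)
  finally have "l1norm (z - x) \<le> 2 * ((1 + \<gamma>) / (1 - \<gamma>)) * (q / D) * \<sigma>"
    using err by (simp add: l1norm_commute[of z x])
  then show "l1norm (z - x) \<le> 2 * (1 + \<gamma>) / (1 - \<gamma>) *
        ((real K - real k + 3 / 2) / (real K - real k - 2 * \<gamma> / (1 - \<gamma>))) * sigma_l1 k z"
    unfolding D_def a_def \<sigma>_def q_def by simp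
qed

theorem theorem5p3:
  fixes \<Phi> :: "real^'n^'m" and y :: "real^'m" and K :: nat and \<gamma> :: real
  assumes "CARD('m) < CARD('n)"
    and "rank \<Phi> = CARD('m)"
    and "0 < K"
    and "null_space_property \<Phi> K \<gamma>"
    and "\<gamma> < 1"
  shows "\<exists>xbar \<epsilon>.
    irls_x \<Phi> y K \<longlonglongrightarrow> xbar \<and>
    irls_eps \<Phi> y K \<longlonglongrightarrow> \<epsilon> \<and>
    real CARD('n) * \<epsilon> \<le> rearr xbar (K + 1) \<and>
    ((\<exists>\<^sub>\<infinity>n. eps_from_iterate \<Phi> y K n) \<longrightarrow> rearr xbar (K + 1) = real CARD('n) * \<epsilon>) \<and>
    (\<epsilon> = 0 \<longrightarrow>
       rearr xbar (K + 1) = real CARD('n) * \<epsilon> \<and>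
       k_sparse K xbar \<and>
       (\<exists>!x. l1_minimizer \<Phi> y x) \<and>
       l1_minimizer \<Phi> y xbar \<and>
       (\<forall>k\<le>K. \<forall>z\<in>feasible \<Phi> y.
          l1norm (z - xbar) \<le> 2 * (1 + \<gamma>) / (1 - \<gamma>) * sigma_l1 k z)) \<and>
    (\<epsilon> > 0 \<longrightarrow>
       (\<exists>!x. is_arg_min (f_eps \<epsilon>) (\<lambda>z. z \<in> feasible \<Phi> y) x) \<and>
       is_arg_min (f_eps \<epsilon>) (\<lambda>z. z \<in> feasible \<Phi> y) xbar) \<and>
    (\<gamma> < 1 - 2 / (real K + 2) \<longleftrightarrow> 2 * \<gamma> / (1 - \<gamma>) < real K) \<and>
    (\<epsilon> > 0 \<and> \<gamma> < 1 - 2 / (real K + 2) \<longrightarrow>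
       (\<forall>z\<in>feasible \<Phi> y. \<forall>k::nat. real k < real K - 2 * \<gamma> / (1 - \<gamma>) \<longrightarrow>
          l1norm (z - xbar) \<le>
            2 * (1 + \<gamma>) / (1 - \<gamma>) *
            ((real K - real k + 3 / 2) / (real K - real k - 2 * \<gamma> / (1 - \<gamma>))) * sigma_l1 k z)) \<and>
    ((\<exists>z\<in>feasible \<Phi> y. \<exists>k::nat. real k < real K - 2 * \<gamma> / (1 - \<gamma>) \<and> k_sparse k z) \<longrightarrow>
       \<not> \<epsilon> > 0)"
proof -
  have K: "K < CARD('n)" by (rule null_space_property_order_less[OF assms(4,1,2)])
  have "surj ((*v) \<Phi>)" using assms(2) by (simp add: full_rank_surjective)
  then have solv: "feasible \<Phi> y \<noteq> {}" by (auto simp: feasible_def surj_def) metis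
  have \<gamma>0: "0 < \<gamma>" using assms(4) by (simp add: null_space_property_def)
  obtain \<epsilon> where \<epsilon>: "irls_eps \<Phi> y K \<longlonglongrightarrow> \<epsilon>" "0 \<le> \<epsilon>" "\<And>n. \<epsilon> \<le> irls_eps \<Phi> y K n"
    using irls_eps_convergent[OF solv K] by blast
  have bounds_iff: "\<gamma> < 1 - 2 / (real K + 2) \<longleftrightarrow> 2 * \<gamma> / (1 - \<gamma>) < real K"
    using assms(5) by (simp add: field_simps)
  show ?thesis
  proof (cases "\<epsilon> = 0")
    case True
    obtain x where x: "irls_x \<Phi> y K \<longlonglongrightarrow> x" "x \<in> feasible \<Phi> y" "rearr x (K + 1) = 0" "k_sparse K x"
      using irls_converges_zero[OF solv K \<epsilon>(1)[unfolded True] assms(4,5)] by blast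
    note min = sparse_l1_is_minimizer[OF assms(4,5) x(2,4)]
    have "l1norm (z - x) \<le> 2 * (1 + \<gamma>) / (1 - \<gamma>) * sigma_l1 k z"
      if "k \<le> K" "z \<in> feasible \<Phi> y" for k z
    proof -
      have "l1norm (z - x) \<le> (1 + \<gamma>) / (1 - \<gamma>) * (l1norm x - l1norm z + 2 * sigma_l1 k z)"
        using null_space_l1_estimate[OF assms(4,5) that(2) x(2) that(1)]
        by (simp add: l1norm_commute)
      also have "\<dots> \<le> (1 + \<gamma>) / (1 - \<gamma>) * (2 * sigma_l1 k z)"
        using sparse_l1_le[OF assms(4,5) x(2,4) that(2)] \<gamma>0 assms(5)
        by (intro mult_left_mono) auto
      finally show ?thesis by (simp add: mult_ac)
    qed
    moreover have "\<exists>!x. l1_minimizer \<Phi> y x"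
      using min sparse_l1_unique[OF assms(4,5) x(2,4)] by blast
    ultimately show ?thesis
      using x \<epsilon>(1) min True bounds_iff by (intro exI[of _ x] exI[of _ 0]) simp
  next
    case False
    then have pos: "0 < \<epsilon>" using \<epsilon>(2) by simp
    obtain x where x: "irls_x \<Phi> y K \<longlonglongrightarrow> x" "x \<in> feasible \<Phi> y"
      and less: "\<And>z. z \<in> feasible \<Phi> y \<Longrightarrow> z \<noteq> x \<Longrightarrow> f_eps \<epsilon> x < f_eps \<epsilon> z"
      using irls_converges_pos[OF solv K \<epsilon>(1) pos \<epsilon>(3)] by blast
    have le: "f_eps \<epsilon> x \<le> f_eps \<epsilon> z" if "z \<in> feasible \<Phi> y" for z
      using less[OF that] by (cases "z = x") auto
    have min: "is_arg_min (f_eps \<epsilon>) (\<lambda>z. z \<in> feasible \<Phi> y) x"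
      using le x(2) by (simp add: is_arg_min_linorder)
    then have uniq: "\<exists>!x. is_arg_min (f_eps \<epsilon>) (\<lambda>z. z \<in> feasible \<Phi> y) x"
      using less by (intro ex1I[of _ x]) (auto simp: is_arg_min_def)
    note rearr = irls_limit_rearr_ge[OF solv K x(1) \<epsilon>(1)]
    note error = f_eps_minimizer_error[OF assms(4,5) K \<epsilon>(2) rearr x(2) le]
    \<comment> \<open>The error of best approximation of a \<open>k\<close>-sparse vector is 0, which forces \<open>\<epsilon> \<le> 0\<close>.\<close>
    have excluded: "\<not> k_sparse k z"
      if z: "z \<in> feasible \<Phi> y" and k: "real k < real K - 2 * \<gamma> / (1 - \<gamma>)" for z k
    proof
      assume "k_sparse k z"
      then have "real CARD('n) * \<epsilon> * (real K - real k - 2 * \<gamma> / (1 - \<gamma>)) \<le> 0"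
        using error(1)[OF z z k] by (simp add: sigma_l1_sparse)
      moreover have "0 < real CARD('n) * \<epsilon> * (real K - real k - 2 * \<gamma> / (1 - \<gamma>))"
        using pos k by (intro mult_pos_pos) auto
      ultimately show False by linarith
    qed
    show ?thesis
    proof (intro exI[of _ x] exI[of _ \<epsilon>] conjI)
      show "(\<exists>\<^sub>\<infinity>n. eps_from_iterate \<Phi> y K n) \<longrightarrow> rearr x (K + 1) = real CARD('n) * \<epsilon>"
        using irls_limit_rearr_eq[OF solv K x(1) \<epsilon>(1)] by blast
    qed (use x(1) \<epsilon>(1) rearr False uniq min bounds_iff error(2) excluded in auto)
  qed
qed

end
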